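(* Let $n\geq 1$ be an integer and let $Grid_{3\times n}$ be the $3\times n$ grid graph. Then $\gamma_{plsR}(Grid_{3\times n})=2n$.
   Context: All graphs are finite, without loops or parallel edges. The grid graph $Grid_{3\times n}$ has its $3n$ vertices arranged in a $3\times n$ rectangular array, two vertices being adjacent if and only if they occupy horizontally or vertically neighboring cells (i.e., it is the Cartesian product of the paths on $3$ and $n$ vertices). For a graph $G=(V,E)$ and $v\in V$, $N[v]=\{v\}\cup\{u : uv\in E\}$ is the closed neighborhood. A perfect locating signed Roman dominating (PLSRD) function on $G=(V,E)$ is a function $f: V\to\{-1,1,2\}$ such that: (C1) each vertex $v$ with $f(v)=-1$ is adjacent to exactly one vertex $u$ with $f(u)=2$; (C2) distinct vertices $v,w$ with $f(v)=f(w)=-1$ have no common neighbor $u$ with $f(u)=2$; (C3) for every vertex $v$, $\sum_{u\in N[v]} f(u)\geq 1$. The weight of $f$ is $f(V)=\sum_{v\in V} f(v)$. The perfect locating signed Roman domination number $\gamma_{plsR}(G)$ is the minimum weight over all PLSRD functions on $G$. *)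

theory Defs
  imports Main "Graph_Theory.Pair_Digraph"
begin

text \<open>
  A graph is a \<^locale>\<open>pair_graph\<close>: finite, loop-free, with a symmetric set of ordered
  vertex pairs as arcs, so that parallel edges cannot occur.
\<close>

definition path_graph :: "nat \<Rightarrow> nat pair_pre_digraph" where
  "path_graph n =
    \<lparr>pverts = {1..n},
     parcs = {(i, j). i \<in> {1..n} \<and> j \<in> {1..n} \<and> (j = i + 1 \<or> i = j + 1)}\<rparr>"

definition cartesian_product ::
  "'a pair_pre_digraph \<Rightarrow> 'b pair_pre_digraph \<Rightarrow> ('a \<times> 'b) pair_pre_digraph" where
  "cartesian_product G H =
    \<lparr>pverts = pverts G \<times> pverts H,
     parcs = {((a, b), (c, d)).
        (a = c \<and> a \<in> pverts G \<and> (b, d) \<in> parcs H) \<or>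
        ((a, c) \<in> parcs G \<and> b = d \<and> b \<in> pverts H)}\<rparr>"

definition grid_graph :: "nat \<Rightarrow> nat \<Rightarrow> (nat \<times> nat) pair_pre_digraph" where
  "grid_graph m n = cartesian_product (path_graph m) (path_graph n)"

definition closed_neighborhood :: "'a pair_pre_digraph \<Rightarrow> 'a \<Rightarrow> 'a set" where
  "closed_neighborhood G v = {v} \<union> {u. (u, v) \<in> parcs G}"

text \<open>
  Functions are total on the vertex type; only the values on \<^term>\<open>pverts G\<close> matter.
\<close>

definition plsrd_function :: "'a pair_pre_digraph \<Rightarrow> ('a \<Rightarrow> int) \<Rightarrow> bool" where
  "plsrd_function G f \<longleftrightarrow>
    (\<forall>v \<in> pverts G. f v \<in> {-1, 1, 2}) \<and>
    (\<forall>v \<in> pverts G. f v = -1 \<longrightarrow> (\<exists>!u. u \<in> pverts G \<and> (u, v) \<in> parcs G \<and> f u = 2)) \<and>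
    (\<forall>v \<in> pverts G. \<forall>w \<in> pverts G. v \<noteq> w \<and> f v = -1 \<and> f w = -1 \<longrightarrow>
      \<not> (\<exists>u \<in> pverts G. (u, v) \<in> parcs G \<and> (u, w) \<in> parcs G \<and> f u = 2)) \<and>
    (\<forall>v \<in> pverts G. (\<Sum>u \<in> closed_neighborhood G v. f u) \<ge> 1)"

definition weight :: "'a pair_pre_digraph \<Rightarrow> ('a \<Rightarrow> int) \<Rightarrow> int" where
  "weight G f = (\<Sum>v \<in> pverts G. f v)"

definition plsrd_number :: "'a pair_pre_digraph \<Rightarrow> int" where
  "plsrd_number G = Min {weight G f | f. plsrd_function G f}"

lemma pair_graph_path_graph: "pair_graph (path_graph n)"
proof
  show "finite (parcs (path_graph n))"
    by (rule finite_subset[of _ "{1..n} \<times> {1..n}"]) (auto simp: path_graph_def)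
qed (auto simp: path_graph_def symmetric_def sym_def arcs_ends_def arc_to_ends_def)

lemma pair_graph_cartesian_product:
  assumes "pair_graph G" "pair_graph H"
  shows "pair_graph (cartesian_product G H)"
proof -
  interpret G: pair_graph G by fact
  interpret H: pair_graph H by fact
  have symG: "(b, a) \<in> parcs G" if "(a, b) \<in> parcs G" for a b
    using G.sym_arcs that by (auto simp: symmetric_def arcs_ends_def arc_to_ends_def elim: symE)
  have symH: "(b, a) \<in> parcs H" if "(a, b) \<in> parcs H" for a b
    using H.sym_arcs that by (auto simp: symmetric_def arcs_ends_def arc_to_ends_def elim: symE)
  have wfG: "a \<in> pverts G" "b \<in> pverts G" if "(a, b) \<in> parcs G" for a b
    using G.arc_fst_in_verts[OF that] G.arc_snd_in_verts[OF that] by auto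
  have wfH: "a \<in> pverts H" "b \<in> pverts H" if "(a, b) \<in> parcs H" for a b
    using H.arc_fst_in_verts[OF that] H.arc_snd_in_verts[OF that] by auto
  have "parcs (cartesian_product G H) \<subseteq>
      (pverts G \<times> pverts H) \<times> (pverts G \<times> pverts H)"
    by (auto simp: cartesian_product_def dest: wfG wfH)
  then have fin: "finite (parcs (cartesian_product G H))"
    by (rule finite_subset) (simp add: G.pair_finite_verts H.pair_finite_verts)
  have sym: "sym (parcs (cartesian_product G H))"
    by (auto simp: sym_def cartesian_product_def dest: symG symH)
  show ?thesis
  proof
    show "symmetric (with_proj (cartesian_product G H))"
      using sym by (simp add: symmetric_def arcs_ends_def arc_to_ends_def)
    show "finite (pverts (cartesian_product G H))"
      by (simp add: cartesian_product_def G.pair_finite_verts H.pair_finite_verts)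
    show "fst e \<noteq> snd e" if "e \<in> parcs (cartesian_product G H)" for e
      using that G.pair_no_loops H.pair_no_loops by (fastforce simp: cartesian_product_def)
  qed (use fin in \<open>auto simp: cartesian_product_def dest: wfG wfH\<close>)
qed

lemma pair_graph_grid_graph: "pair_graph (grid_graph m n)"
  by (simp add: grid_graph_def pair_graph_cartesian_product pair_graph_path_graph)

text \<open>
  On a graph the minimum is over a finite nonempty set of weights, hence it is attained.
\<close>

lemma (in pair_graph) finite_plsrd_weights: "finite {weight G f | f. plsrd_function G f}"
proof (rule finite_subset)
  let ?R = "{h. \<forall>x. (x \<in> pverts G \<longrightarrow> h x \<in> {-1, 1, 2 :: int}) \<and> (x \<notin> pverts G \<longrightarrow> h x = 0)}"
  show "{weight G f | f. plsrd_function G f} \<subseteq> weight G ` ?R"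
  proof safe
    fix f assume "plsrd_function G f"
    then have "(\<lambda>x. if x \<in> pverts G then f x else 0) \<in> ?R"
      by (auto simp: plsrd_function_def)
    moreover have "weight G f = weight G (\<lambda>x. if x \<in> pverts G then f x else 0)"
      by (simp add: weight_def)
    ultimately show "weight G f \<in> weight G ` ?R" by blast
  qed
  show "finite (weight G ` ?R)"
    by (intro finite_imageI finite_set_of_finite_funs) (auto simp: pair_finite_verts)
qed

lemma (in pair_graph) plsrd_function_one: "plsrd_function G (\<lambda>_. 1)"
proof -
  have "1 \<le> card (closed_neighborhood G v)" if "v \<in> pverts G" for v
  proof -
    have "closed_neighborhood G v \<subseteq> pverts G"
      using that arc_fst_in_verts by (fastforce simp: closed_neighborhood_def)
    then have "finite (closed_neighborhood G v)"
      using pair_finite_verts finite_subset by blast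
    moreover have "closed_neighborhood G v \<noteq> {}" by (simp add: closed_neighborhood_def)
    ultimately show ?thesis by (simp add: Suc_leI card_gt_0_iff)
  qed
  then show ?thesis by (simp add: plsrd_function_def)
qed

lemma (in pair_graph) plsrd_number_attained:
  "\<exists>f. plsrd_function G f \<and> weight G f = plsrd_number G"
  using Min_in[OF finite_plsrd_weights] plsrd_function_one
  unfolding plsrd_number_def by fastforce

lemma (in pair_graph) plsrd_number_le:
  "plsrd_function G f \<Longrightarrow> plsrd_number G \<le> weight G f"
  unfolding plsrd_number_def by (rule Min_le[OF finite_plsrd_weights]) blast

end

theory Submission
  imports Defs
begin

text \<open>
  The upper bound is attained by a middle row of twos between two alternating rows of opposite
  sign.

  For the lower bound, sweep over the columns from left to right. All conditions at a column
  involve only that column and its two neighbors, so it suffices to find a potential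
  \<open>excess b c\<close> of two consecutive columns that increases by at most \<open>weight b - 2\<close> from
  \<open>(a, b)\<close> to \<open>(b, c)\<close> and vanishes at both ends of the grid. Checking the potential is a finite
  computation over triples of columns.
\<close>

section \<open>Local form of the conditions on a grid\<close>

text \<open>
  For boundary vertices the list contains cells off the grid (with a coordinate \<open>0\<close>, \<open>m + 1\<close> or
  \<open>n + 1\<close>); \<open>zero_extension\<close> below gives them the value \<open>0\<close>, which no condition notices.
\<close>

definition neighbors :: "nat \<times> nat \<Rightarrow> (nat \<times> nat) list" where
  "neighbors v = [(fst v - 1, snd v), (fst v + 1, snd v), (fst v, snd v - 1), (fst v, snd v + 1)]"

text \<open>(C2) is read from the common neighbor, as a bound on the number of -1s around a 2, so
  that every condition involves a single closed neighborhood.\<close>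

fun admissible :: "int \<Rightarrow> int list \<Rightarrow> bool" where
  "admissible x ys \<longleftrightarrow> 1 \<le> x + sum_list ys \<and> (x = -1 \<longrightarrow> count_list ys 2 = 1) \<and>
    (x = 2 \<longrightarrow> count_list ys (-1) \<le> 1)"

lemma pverts_grid_graph: "pverts (grid_graph m n) = {1..m} \<times> {1..n}"
  by (simp add: grid_graph_def cartesian_product_def path_graph_def)

text \<open>Coordinates on the grid start at 1, so truncated subtraction never gives back
  \<open>v\<close>.\<close>

lemma distinct_neighbors:
  "v \<in> pverts (grid_graph m n) \<Longrightarrow> distinct (neighbors v) \<and> v \<notin> set (neighbors v)"
  by (auto simp: pverts_grid_graph neighbors_def)

lemma parcs_grid_graph_iff:
  "(u, v) \<in> parcs (grid_graph m n) \<longleftrightarrow>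
    u \<in> pverts (grid_graph m n) \<and> v \<in> pverts (grid_graph m n) \<and> u \<in> set (neighbors v)"
  by (cases u; cases v)
    (auto simp: grid_graph_def cartesian_product_def path_graph_def neighbors_def)

lemma parcs_grid_graph_commute:
  "(u, v) \<in> parcs (grid_graph m n) \<longleftrightarrow> (v, u) \<in> parcs (grid_graph m n)"
  by (auto simp: grid_graph_def cartesian_product_def path_graph_def)

lemma count_list_map_distinct:
  "distinct xs \<Longrightarrow> count_list (map g xs) y = card {x \<in> set xs. g x = y}"
proof -
  assume "distinct xs"
  then have "card {x \<in> set xs. g x = y} = length (filter (\<lambda>x. g x = y) xs)"
    by (metis distinct_card distinct_filter set_filter)
  then show ?thesis
    by (induction xs) (simp_all add: count_list_eq_length_filter filter_map o_def eq_commute)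
qed

lemma card_Collect_eq_1_iff: "card {x. P x} = Suc 0 \<longleftrightarrow> (\<exists>!x. P x)"
proof -
  have "card {x. P x} = Suc 0 \<longleftrightarrow> (\<exists>x. \<forall>y. P y \<longleftrightarrow> y = x)"
    by (simp add: card_1_singleton_iff set_eq_iff)
  then show ?thesis
    by metis
qed

definition zero_extension :: "nat \<Rightarrow> nat \<Rightarrow> (nat \<times> nat \<Rightarrow> int) \<Rightarrow> nat \<times> nat \<Rightarrow> int" where
  "zero_extension m n f v = (if v \<in> pverts (grid_graph m n) then f v else 0)"

lemma plsrd_function_grid_iff:
  fixes m n :: nat and f :: "nat \<times> nat \<Rightarrow> int"
  defines "g \<equiv> zero_extension m n f"
  shows "plsrd_function (grid_graph m n) f \<longleftrightarrow>
    (\<forall>v \<in> pverts (grid_graph m n). g v \<in> {-1, 1, 2} \<and> admissible (g v) (map g (neighbors v)))"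
proof -
  let ?G = "grid_graph m n"
  let ?V = "pverts ?G"
  have g: "g v = f v" if "v \<in> ?V" for v
    using that by (simp add: g_def zero_extension_def)
  have g0: "g v = 0" if "v \<notin> ?V" for v
    using that by (simp add: g_def zero_extension_def)
  \<comment> \<open>Off-grid cells have \<open>g\<close>-value 0, so \<open>y \<noteq> 0\<close>
    keeps them out of the left-hand set.\<close>
  have adj: "{u \<in> set (neighbors v). g u = y} = {u \<in> ?V. (u, v) \<in> parcs ?G \<and> f u = y}"
    if "v \<in> ?V" "y \<noteq> 0" for v y
    unfolding parcs_grid_graph_iff using that g g0 by metis
  have count: "count_list (map g (neighbors v)) y = card {u \<in> ?V. (u, v) \<in> parcs ?G \<and> f u = y}"
    if "v \<in> ?V" "y \<noteq> 0" for v y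
    using adj[OF that] distinct_neighbors[OF that(1)] by (simp add: count_list_map_distinct)
  have nbh: "(\<Sum>u \<in> closed_neighborhood ?G v. f u) = g v + sum_list (map g (neighbors v))"
    if "v \<in> ?V" for v
  proof -
    have "closed_neighborhood ?G v = insert v (set (neighbors v)) \<inter> ?V"
      using that by (auto simp: closed_neighborhood_def parcs_grid_graph_iff)
    then have "(\<Sum>u \<in> closed_neighborhood ?G v. f u) = (\<Sum>u \<in> insert v (set (neighbors v)). g u)"
      by (simp add: sum.inter_restrict g_def zero_extension_def)
    also have "\<dots> = g v + sum_list (map g (neighbors v))"
      using distinct_neighbors[OF that] by (simp add: sum_list_distinct_conv_sum_set)
    finally show ?thesis .
  qed
  have fin: "finite {u \<in> ?V. (u, v) \<in> parcs ?G \<and> f u = y}" for v y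
    by (simp add: pverts_grid_graph)
  have C1: "(\<exists>!u. u \<in> ?V \<and> (u, v) \<in> parcs ?G \<and> f u = 2) \<longleftrightarrow>
      count_list (map g (neighbors v)) 2 = 1" if "v \<in> ?V" for v
    by (simp add: count[OF that] card_Collect_eq_1_iff)
  have C2: "(\<forall>v \<in> ?V. \<forall>w \<in> ?V. v \<noteq> w \<and> f v = -1 \<and> f w = -1 \<longrightarrow>
        \<not> (\<exists>u \<in> ?V. (u, v) \<in> parcs ?G \<and> (u, w) \<in> parcs ?G \<and> f u = 2)) \<longleftrightarrow>
      (\<forall>u \<in> ?V. f u = 2 \<longrightarrow> count_list (map g (neighbors u)) (-1) \<le> 1)"
    (is "_ = ?R")
  proof -
    \<comment> \<open>At most one -1 around \<open>u\<close> means that any two of them coincide;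
      symmetry of the arcs then turns this into (C2).\<close>
    have "?R \<longleftrightarrow> (\<forall>u \<in> ?V. f u = 2 \<longrightarrow>
        (\<forall>v \<in> {v \<in> ?V. (v, u) \<in> parcs ?G \<and> f v = -1}.
         \<forall>w \<in> {v \<in> ?V. (v, u) \<in> parcs ?G \<and> f v = -1}. v = w))"
      using fin by (simp add: count card_le_Suc0_iff_eq)
    then show ?thesis
      using parcs_grid_graph_commute[of _ _ m n] by blast
  qed
  show ?thesis
    unfolding plsrd_function_def C2 admissible.simps
    using g nbh C1 by auto
qed

section \<open>Columns of height 3 and the potential\<close>

type_synonym column = "int \<times> int \<times> int"

definition columns :: "column list" where
  "columns = List.product [-1, 1, 2] (List.product [-1, 1, 2] [-1, 1, 2])"

lemma mem_columns_iff:
  "(x, y, z) \<in> set columns \<longleftrightarrow> x \<in> {-1, 1, 2} \<and> y \<in> {-1, 1, 2} \<and> z \<in> {-1, 1, 2}"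
  by (simp only: columns_def set_product mem_Times_iff fst_conv snd_conv list.set)

fun column_weight :: "column \<Rightarrow> int" where
  "column_weight (b1, b2, b3) = b1 + b2 + b3"

text \<open>The cells above row 1 and below row 3 are dropped; the others keep the order of
  \<open>neighbors\<close>.\<close>

fun column_admissible :: "column \<Rightarrow> column \<Rightarrow> column \<Rightarrow> bool" where
  "column_admissible (a1, a2, a3) (b1, b2, b3) (c1, c2, c3) \<longleftrightarrow>
    admissible b1 [b2, a1, c1] \<and> admissible b2 [b1, b3, a2, c2] \<and> admissible b3 [b2, a3, c3]"

text \<open>
  A horizontally adjacent pair \<open>2, -1\<close> is accounted for when the sweep has passed only one of the
  two columns, hence the summand \<open>right - left\<close>. The other summand was found by a computer search.
\<close>

fun excess :: "column \<Rightarrow> column \<Rightarrow> int" where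
  "excess (a1, a2, a3) (b1, b2, b3) =
    (let left = count_list [(a1, b1), (a2, b2), (a3, b3)] (-1, 2);
         right = count_list [(a1, b1), (a2, b2), (a3, b3)] (2, -1);
         minus = count_list [a1, a2, a3] (-1);
         a = a1 + a2 + a3; b = b1 + b2 + b3; ab = a1 * b1 + a2 * b2 + a3 * b3
     in int right - int left +
       (if minus = 0 \<and> right < 2 then 0
        else if minus < 2 \<and> a + b < 4 then 0
        else if count_list [b1, b2, b3] (-1) = 0 \<and> 0 < a2 * b2 then -1
        else if minus = 1 \<and> 0 < b2 then 0
        else if 3 \<le> b then -1
        else if left = 0 \<and> -1 \<le> ab then 0
        else if count_list [b1, b2, b3] 2 = 1 \<and> -4 \<le> ab then -1
        else if 0 < count_list [a1, a2, a3] 2 \<and> a2 * b2 < 0 then 0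
        else if 0 < a2 then 1 else -1))"

text \<open>The zero column stands in for the missing neighbor of an end column; 28 * 27 * 28
  triples are evaluated.\<close>

lemma excess_step_columns:
  "list_all (\<lambda>a. list_all (\<lambda>b. list_all (\<lambda>c.
      column_admissible a b c \<longrightarrow> excess b c + 2 \<le> excess a b + column_weight b)
    ((0, 0, 0) # columns)) columns) ((0, 0, 0) # columns)"
  by code_simp

lemma excess_step:
  assumes "a \<in> set ((0, 0, 0) # columns)" "b \<in> set columns" "c \<in> set ((0, 0, 0) # columns)"
    and "column_admissible a b c"
  shows "excess b c + 2 \<le> excess a b + column_weight b"
  using excess_step_columns assms unfolding list_all_iff by blast

lemma excess_zero_left: "excess (0, 0, 0) b = 0"
  by (cases b) simp

text \<open>Here \<open>left\<close>, \<open>right\<close> and \<open>ab\<close> are 0, so the test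
  \<open>left = 0 \<and> -1 \<le> ab\<close> succeeds if it is reached; the earlier branches with
  value -1 need \<open>0 < a2 * b2\<close> or \<open>3 \<le> b\<close>.\<close>

lemma excess_zero_right: "excess a (0, 0, 0) = 0"
  by (cases a) simp

lemma telescoping_lower_bound:
  fixes \<phi> w :: "nat \<Rightarrow> int"
  assumes "\<And>j. j < n \<Longrightarrow> \<phi> (Suc j) + d \<le> \<phi> j + w (Suc j)"
  shows "\<phi> n + d * int n \<le> \<phi> 0 + (\<Sum>j = 1..n. w j)"
  using assms
proof (induction n)
  case (Suc n)
  then have "\<phi> n + d * int n \<le> \<phi> 0 + (\<Sum>j = 1..n. w j)" "\<phi> (Suc n) + d \<le> \<phi> n + w (Suc n)"
    by simp_all
  then show ?case
    by (simp add: algebra_simps)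
qed simp

section \<open>Grid functions as sequences of columns; the lower bound\<close>

definition column :: "nat \<Rightarrow> (nat \<times> nat \<Rightarrow> int) \<Rightarrow> nat \<Rightarrow> column" where
  "column n f j =
    (let g = zero_extension 3 n f in (g (1, j), g (2, j), g (3, j)))"

lemma column_outside: "j \<notin> {1..n} \<Longrightarrow> column n f j = (0, 0, 0)"
  by (auto simp: column_def zero_extension_def pverts_grid_graph)

lemma weight_grid_graph_3: "weight (grid_graph 3 n) f = (\<Sum>j = 1..n. column_weight (column n f j))"
proof -
  have "{1..3} = {1, 2, 3 :: nat}"
    by auto
  then have "weight (grid_graph 3 n) f = (\<Sum>j = 1..n. f (1, j) + f (2, j) + f (3, j))"
    by (simp add: weight_def pverts_grid_graph sum.cartesian_product' sum.distrib add.assoc)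
  then show ?thesis
    by (simp add: column_def zero_extension_def pverts_grid_graph)
qed

lemma plsrd_function_grid_3_iff:
  "plsrd_function (grid_graph 3 n) f \<longleftrightarrow>
    (\<forall>j \<in> {1..n}. column n f j \<in> set columns \<and>
      column_admissible (column n f (j - 1)) (column n f j) (column n f (j + 1)))"
proof -
  let ?g = "zero_extension 3 n f"
  have outside: "?g (0, j) = 0" "?g (4, j) = 0" for j
    by (simp_all add: zero_extension_def pverts_grid_graph)
  \<comment> \<open>The off-grid cell comes first in the list for row 1 and second for row 3; its 0
    affects neither the sum nor the counts of 2 and -1.\<close>
  have skip_zero: "admissible x (0 # ys) = admissible x ys"
    "admissible x (y # 0 # ys) = admissible x (y # ys)" for x y ys
    by simp_all
  have "(\<forall>i \<in> {1, 2, 3}. ?g (i, j) \<in> {-1, 1, 2} \<and>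
        admissible (?g (i, j)) (map ?g (neighbors (i, j)))) \<longleftrightarrow>
      column n f j \<in> set columns \<and>
      column_admissible (column n f (j - 1)) (column n f j) (column n f (j + 1))" for j
    by (simp add: neighbors_def column_def Let_def mem_columns_iff outside skip_zero
        del: admissible.simps flip: numeral_2_eq_2) blast
  moreover have "{1..3} = {1, 2, 3 :: nat}"
    by auto
  ultimately show ?thesis
    unfolding plsrd_function_grid_iff pverts_grid_graph by (simp only: mem_Times_iff) blast
qed

lemma weight_grid_3_lower_bound:
  assumes "plsrd_function (grid_graph 3 n) f"
  shows "2 * int n \<le> weight (grid_graph 3 n) f"
proof -
  let ?c = "column n f"
  have range: "?c j \<in> set ((0, 0, 0) # columns)" for j
    using assms column_outside[of j n f] plsrd_function_grid_3_iff[of n f]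
    by (cases "j \<in> {1..n}") auto
  have "excess (?c (Suc j)) (?c (Suc (Suc j))) + 2
      \<le> excess (?c j) (?c (Suc j)) + column_weight (?c (Suc j))" if "j < n" for j
  proof (rule excess_step[OF range _ range])
    have "Suc j \<in> {1..n}"
      using that by simp
    then show "?c (Suc j) \<in> set columns" "column_admissible (?c j) (?c (Suc j)) (?c (Suc (Suc j)))"
      using assms unfolding plsrd_function_grid_3_iff by fastforce+
  qed
  \<comment> \<open>The potentials at \<open>0\<close> and at \<open>n\<close> involve the zero
    columns \<open>0\<close> and \<open>n + 1\<close>, so both vanish.\<close>
  from telescoping_lower_bound[of n "\<lambda>j. excess (?c j) (?c (Suc j))", OF this]
  show ?thesis
    by (simp add: weight_grid_graph_3 column_outside excess_zero_left excess_zero_right)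
qed

section \<open>The extremal function\<close>

text \<open>\<open>fst v div 2\<close> is 0 in row 1 and 1 in row 3, which gives the outer rows
  opposite signs.\<close>

definition alternating :: "nat \<times> nat \<Rightarrow> int" where
  "alternating v = (if fst v = 2 then 2 else if even (fst v div 2 + snd v) then 1 else -1)"

lemma column_alternating:
  "j \<in> {1..n} \<Longrightarrow> column n alternating j = (if even j then (1, 2, -1) else (-1, 2, 1))"
  by (simp add: column_def zero_extension_def pverts_grid_graph alternating_def)

text \<open>The only 2 next to a -1 is the middle of its column, which has no other -1 next to it.
  The tightest sum at an outer 1 is 1 + 2 - 1 - 1 = 1.\<close>

lemma plsrd_function_alternating: "plsrd_function (grid_graph 3 n) alternating"
  unfolding plsrd_function_grid_3_iff
proof (intro ballI conjI)
  let ?c = "column n alternating"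
  fix j assume j: "j \<in> {1..n}"
  then show "?c j \<in> set columns"
    by (simp add: column_alternating mem_columns_iff)
  \<comment> \<open>Neighboring columns differ in parity; beyond an end of the grid the column is
    zero.\<close>
  have "?c (j - 1) = (0, 0, 0) \<or> ?c (j - 1) = (if even j then (-1, 2, 1) else (1, 2, -1))"
  proof (cases "j = 1")
    case False
    with j have "j - 1 \<in> {1..n}"
      by auto
    then show ?thesis
      using j by (simp add: column_alternating)
  qed (simp add: column_outside)
  moreover have "?c (j + 1) = (0, 0, 0) \<or> ?c (j + 1) = (if even j then (-1, 2, 1) else (1, 2, -1))"
  proof (cases "j = n")
    case False
    with j have "j + 1 \<in> {1..n}"
      by auto
    then show ?thesis
      using j by (simp add: column_alternating)
  qed (simp add: column_outside)
  ultimately show "column_admissible (?c (j - 1)) (?c j) (?c (j + 1))"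
    using j by (auto simp: column_alternating)
qed

lemma weight_alternating: "weight (grid_graph 3 n) alternating = 2 * int n"
proof -
  have "column_weight (column n alternating j) = 2" if "j \<in> {1..n}" for j
    using that by (simp add: column_alternating)
  then show ?thesis
    by (simp add: weight_grid_graph_3)
qed

theorem theorem5:
  fixes n :: nat
  assumes "n \<ge> 1"
  shows "plsrd_number (grid_graph 3 n) = 2 * int n"
proof (rule antisym)
  show "plsrd_number (grid_graph 3 n) \<le> 2 * int n"
    using pair_graph.plsrd_number_le[OF pair_graph_grid_graph plsrd_function_alternating]
    by (simp add: weight_alternating)
  show "2 * int n \<le> plsrd_number (grid_graph 3 n)"
    using pair_graph.plsrd_number_attained[OF pair_graph_grid_graph] weight_grid_3_lower_bound
    by metis
qed

end
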